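(* Suppose no anticipation holds ($Y_t(1)=Y_t(0)$ for all $t\in\{1,\dots,\mathcal T-1\}$), the data are an i.i.d. sample $\{S_i\}_{i=1}^n$ of $S=(Y_1,\dots,Y_{\mathcal T},G,X)$, and overlap holds ($p_g(X)=\mathbb P(G=g\mid X)>0$ almost surely for all $g=1,\dots,N_G+1$). Let $\theta=\mathbb E[Y_{\mathcal T}(1)-Y_{\mathcal T}(0)\mid G=1]$ and let $\phi$ be the moment function $$\phi(S;m_\Delta,p,w;\pi_1)=\frac1{\pi_1}\Big(\mathcal G_1-\sum_{g=2}^{N_G+1}w_g(X)\frac{p_1(X)}{p_g(X)}\mathcal G_g\Big)(\Delta Y-m_\Delta(X)).$$ (i) If the parallel trends assumption (PT) holds, then $$\theta=\mathbb E[\phi(S;m_\Delta,\tilde p,\tilde w;\pi_1)]=\mathbb E[\phi(S;\tilde m_\Delta,p,\tilde w;\pi_1)]$$ for any set of weights $\tilde w=(\tilde w_2,\dots,\tilde w_{N_G+1})$ that sum to one, any non-zero functions $\tilde p=(\tilde p_1,\dots,\tilde p_{N_G+1})$, and any function $\tilde m_\Delta$. (ii) If the synthetic control assumption (SC) holds, then $$\theta=\mathbb E[\phi(S;\tilde m_\Delta,p,w;\pi_1)]$$ for any function $\tilde m_\Delta$, where $w$ is the set of weights satisfying the displayed equation in assumption (SC).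
   Context: Setting. There are $N_G+1$ groups; $G\in\{1,\dots,N_G+1\}$ is an individual's group and $\mathcal G_g=\mathbf 1\{G=g\}$. Time periods are $t=1,\dots,\mathcal T$. In periods $1,\dots,\mathcal T-1$ all groups are untreated; in the final period $\mathcal T$ group $1$ is treated and groups $2,\dots,N_G+1$ remain untreated. $Y_t(1),Y_t(0)$, $t=1,\dots,\mathcal T$, are potential outcomes with and without the final-period treatment, and the observed outcome is $Y_t=\mathcal G_1Y_t(1)+(1-\mathcal G_1)Y_t(0)$. $X$ is a set of time-invariant covariates with support $\mathcal X$. Notation. $\Delta Y=Y_{\mathcal T}-Y_{\mathcal T-1}$; $m_\Delta(X)=\mathbb E[\Delta Y\mid G\neq1,X]$; $p_g(X)=\mathbb P(G=g\mid X)$, $p=(p_1,\dots,p_{N_G+1})$; $\pi_1=\mathbb P(G=1)$. Assumption (PT): for each $g\ge2$, $\mathbb E[Y_{\mathcal T}(0)-Y_{\mathcal T-1}(0)\mid G=1,X]=\mathbb E[Y_{\mathcal T}(0)-Y_{\mathcal T-1}(0)\mid G=g,X]$ almost surely. Assumption (SC): there is a vector of weight functions $w=(w_2,\dots,w_{N_G+1})$ on $\mathcal X$, with elements summing to one (not necessarily nonnegative), such that for almost all $x\in\mathcal X$, $$\mathbb E[Y_t(0)\mid G=1,X=x]=\sum_{g=2}^{N_G+1}w_g(x)\,\mathbb E[Y_t(0)\mid G=g,X=x],\qquad t=1,\dots,\mathcal T;$$ furthermore $\mathcal T\ge N_G$. *)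

theory Defs
  imports "HOL-Probability.Probability"
begin

text \<open>
  \<open>cond_mean P N X Z x\<close> is the regression function \<open>E[Z | X = x]\<close> under \<open>P\<close>: a measurable
  \<open>h\<close> with \<open>h(X) = E[Z | \<sigma>(X)]\<close> almost surely.  It is determined up to null sets of the law
  of \<open>X\<close> under \<open>P\<close>; existence is \<open>cond_mean_spec\<close> below.
\<close>

definition cond_mean ::
  "'a measure \<Rightarrow> 'x measure \<Rightarrow> ('a \<Rightarrow> 'x) \<Rightarrow> ('a \<Rightarrow> real) \<Rightarrow> 'x \<Rightarrow> real" where
  "cond_mean P N X Z =
     (SOME h. h \<in> borel_measurable N \<and>
        (AE \<omega> in P. h (X \<omega>) = real_cond_exp P (vimage_algebra (space P) X N) Z \<omega>))"

lemma factor_through_vimage_algebra: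
  fixes f :: "'a \<Rightarrow> real"
  assumes X: "X \<in> S \<rightarrow> space N" and f: "f \<in> borel_measurable (vimage_algebra S X N)"
  obtains h where "h \<in> borel_measurable N" "\<And>\<omega>. \<omega> \<in> S \<Longrightarrow> h (X \<omega>) = f \<omega>"
proof -
  have "\<exists>B. B \<in> sets N \<and> {\<omega> \<in> S. f \<omega> < real_of_rat q} = X -` B \<inter> S" for q
  proof -
    have "{\<omega> \<in> space (vimage_algebra S X N). f \<omega> < real_of_rat q} \<in> sets (vimage_algebra S X N)"
      using f by measurable
    then show ?thesis
      unfolding sets_vimage_algebra2[OF X] by auto
  qed
  then obtain B where B: "\<And>q. B q \<in> sets N"
    and Beq: "\<And>q. {\<omega> \<in> S. f \<omega> < real_of_rat q} = X -` B q \<inter> S"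
    by metis
  define k where "k x = (INF q. if x \<in> B q then ereal (real_of_rat q) else \<infinity>)" for x
  have k: "k \<in> borel_measurable N"
    unfolding k_def using B by measurable
  have "k (X \<omega>) = ereal (f \<omega>)" if "\<omega> \<in> S" for \<omega>
  proof -
    have mem: "X \<omega> \<in> B q \<longleftrightarrow> f \<omega> < real_of_rat q" for q
      using Beq[of q] that by auto
    show ?thesis
      unfolding k_def mem
    proof (rule antisym)
      show "ereal (f \<omega>) \<le> (INF q. if f \<omega> < real_of_rat q then ereal (real_of_rat q) else \<infinity>)"
        by (rule INF_greatest) auto
      show "(INF q. if f \<omega> < real_of_rat q then ereal (real_of_rat q) else \<infinity>) \<le> ereal (f \<omega>)"
      proof (rule ereal_le_epsilon2)
        fix e :: real assume "0 < e"
        then obtain q where q: "f \<omega> < real_of_rat q" "real_of_rat q < f \<omega> + e"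
          using of_rat_dense[of "f \<omega>" "f \<omega> + e"] by auto
        show "(INF q. if f \<omega> < real_of_rat q then ereal (real_of_rat q) else \<infinity>)
                \<le> ereal (f \<omega>) + ereal e"
          by (rule INF_lower2[of q]) (use q in auto)
      qed
    qed
  qed
  then show ?thesis
    using k by (intro that[of "\<lambda>x. real_of_ereal (k x)"]) auto
qed

lemma cond_mean_spec:
  assumes "X \<in> measurable P N"
  shows "cond_mean P N X Z \<in> borel_measurable N"
    and "AE \<omega> in P. cond_mean P N X Z (X \<omega>) = real_cond_exp P (vimage_algebra (space P) X N) Z \<omega>"
proof -
  have "X \<in> space P \<rightarrow> space N"
    using assms by (auto dest: measurable_space)
  then obtain h where "h \<in> borel_measurable N"
    "\<And>\<omega>. \<omega> \<in> space P \<Longrightarrow> h (X \<omega>) = real_cond_exp P (vimage_algebra (space P) X N) Z \<omega>"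
    by (rule factor_through_vimage_algebra[OF _ borel_measurable_cond_exp[of P _ Z]]) blast
  then have "\<exists>h. h \<in> borel_measurable N \<and>
      (AE \<omega> in P. h (X \<omega>) = real_cond_exp P (vimage_algebra (space P) X N) Z \<omega>)"
    by (auto intro!: exI[of _ h])
  from someI_ex[OF this]
  show "cond_mean P N X Z \<in> borel_measurable N"
    and "AE \<omega> in P. cond_mean P N X Z (X \<omega>) = real_cond_exp P (vimage_algebra (space P) X N) Z \<omega>"
    unfolding cond_mean_def by auto
qed

text \<open>The conditional probability measure \<open>P(\<cdot> | G \<in> J)\<close>.\<close>

definition given_group :: "'a measure \<Rightarrow> ('a \<Rightarrow> nat) \<Rightarrow> nat set \<Rightarrow> 'a measure" where
  "given_group M G J = uniform_measure M {\<omega> \<in> space M. G \<omega> \<in> J}"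

text \<open>\<open>E[Z | G \<in> J, X = x]\<close>: the regression function of \<open>Z\<close> on \<open>X\<close> under \<open>P(\<cdot> | G \<in> J)\<close>.
  It is determined only where \<open>P(G \<in> J | X) > 0\<close>; under overlap this is almost everywhere, so
  the almost sure statements below do not depend on the version.\<close>

definition group_mean ::
  "'a measure \<Rightarrow> 'x measure \<Rightarrow> ('a \<Rightarrow> 'x) \<Rightarrow> ('a \<Rightarrow> nat) \<Rightarrow> nat set \<Rightarrow> ('a \<Rightarrow> real) \<Rightarrow> 'x \<Rightarrow> real" where
  "group_mean M N X G J Z = cond_mean (given_group M G J) N X Z"

text \<open>\<open>p\<^sub>g(x) = P(G = g | X = x)\<close>.\<close>

definition group_prob ::
  "'a measure \<Rightarrow> 'x measure \<Rightarrow> ('a \<Rightarrow> 'x) \<Rightarrow> ('a \<Rightarrow> nat) \<Rightarrow> nat \<Rightarrow> 'x \<Rightarrow> real" where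
  "group_prob M N X G g = cond_mean M N X (\<lambda>\<omega>. of_bool (G \<omega> = g))"

definition outcome ::
  "(nat \<Rightarrow> 'a \<Rightarrow> real) \<Rightarrow> (nat \<Rightarrow> 'a \<Rightarrow> real) \<Rightarrow> ('a \<Rightarrow> nat) \<Rightarrow> nat \<Rightarrow> 'a \<Rightarrow> real" where
  "outcome Y1 Y0 G t \<omega> =
     of_bool (G \<omega> = 1) * Y1 t \<omega> + (1 - of_bool (G \<omega> = 1)) * Y0 t \<omega>"

text \<open>The data vector \<open>S = (Y\<^sub>1, \<dots>, Y\<^sub>T, G, X)\<close> and the measurable space it lives in.\<close>

definition data_space ::
  "nat \<Rightarrow> nat \<Rightarrow> 'x measure \<Rightarrow> ((nat \<Rightarrow> real) \<times> nat \<times> 'x) measure" where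
  "data_space NG T N = PiM {1..T} (\<lambda>_. borel) \<Otimes>\<^sub>M (count_space {1..NG + 1} \<Otimes>\<^sub>M N)"

definition data ::
  "nat \<Rightarrow> (nat \<Rightarrow> 'a \<Rightarrow> real) \<Rightarrow> (nat \<Rightarrow> 'a \<Rightarrow> real) \<Rightarrow> ('a \<Rightarrow> nat) \<Rightarrow> ('a \<Rightarrow> 'x)
     \<Rightarrow> 'a \<Rightarrow> (nat \<Rightarrow> real) \<times> nat \<times> 'x" where
  "data T Y1 Y0 G X \<omega> = (\<lambda>t\<in>{1..T}. outcome Y1 Y0 G t \<omega>, G \<omega>, X \<omega>)"

definition iid_sample :: "'b measure \<Rightarrow> nat \<Rightarrow> 's measure \<Rightarrow> (nat \<Rightarrow> 'b \<Rightarrow> 's) \<Rightarrow> bool" where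
  "iid_sample Q n L S \<longleftrightarrow>
     prob_space Q \<and> prob_space.indep_vars Q (\<lambda>_. L) S {1..n} \<and>
     (\<forall>i\<in>{1..n}. distr Q L (S i) = L)"

definition phi ::
  "nat \<Rightarrow> nat \<Rightarrow> ('x \<Rightarrow> real) \<Rightarrow> (nat \<Rightarrow> 'x \<Rightarrow> real) \<Rightarrow> (nat \<Rightarrow> 'x \<Rightarrow> real) \<Rightarrow> real
     \<Rightarrow> (nat \<Rightarrow> real) \<times> nat \<times> 'x \<Rightarrow> real" where
  "phi NG T m p w \<pi>1 = (\<lambda>(y, g, x).
     1 / \<pi>1 *
     (of_bool (g = 1) - (\<Sum>h = 2..NG + 1. w h x * (p 1 x / p h x) * of_bool (g = h))) *
     ((y T - y (T - 1)) - m x))"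

definition weights :: "nat \<Rightarrow> 'x measure \<Rightarrow> (nat \<Rightarrow> 'x \<Rightarrow> real) \<Rightarrow> bool" where
  "weights NG N w \<longleftrightarrow>
     (\<forall>g\<in>{2..NG + 1}. w g \<in> borel_measurable N) \<and>
     (\<forall>x\<in>space N. (\<Sum>g = 2..NG + 1. w g x) = 1)"

definition parallel_trends ::
  "'a measure \<Rightarrow> 'x measure \<Rightarrow> nat \<Rightarrow> nat \<Rightarrow> (nat \<Rightarrow> 'a \<Rightarrow> real) \<Rightarrow> ('a \<Rightarrow> nat) \<Rightarrow> ('a \<Rightarrow> 'x) \<Rightarrow> bool"
  where
  "parallel_trends M N NG T Y0 G X \<longleftrightarrow>
     (\<forall>g\<in>{2..NG + 1}. AE \<omega> in M.
        group_mean M N X G {1} (\<lambda>\<omega>. Y0 T \<omega> - Y0 (T - 1) \<omega>) (X \<omega>) =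
        group_mean M N X G {g} (\<lambda>\<omega>. Y0 T \<omega> - Y0 (T - 1) \<omega>) (X \<omega>))"

text \<open>\<open>w\<close> is a vector of weight functions witnessing the synthetic control assumption.\<close>

definition synthetic_control ::
  "'a measure \<Rightarrow> 'x measure \<Rightarrow> nat \<Rightarrow> nat \<Rightarrow> (nat \<Rightarrow> 'a \<Rightarrow> real) \<Rightarrow> ('a \<Rightarrow> nat) \<Rightarrow> ('a \<Rightarrow> 'x)
     \<Rightarrow> (nat \<Rightarrow> 'x \<Rightarrow> real) \<Rightarrow> bool" where
  "synthetic_control M N NG T Y0 G X w \<longleftrightarrow>
     weights NG N w \<and>
     (AE x in distr M N X. \<forall>t\<in>{1..T}.
        group_mean M N X G {1} (Y0 t) x =
        (\<Sum>g = 2..NG + 1. w g x * group_mean M N X G {g} (Y0 t) x)) \<and>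
     NG \<le> T"

end

theory Submission
  imports Defs
begin

text \<open>
  Write \<open>\<mu>\<^sub>g(X)\<close> for the mean untreated trend of group \<open>g\<close> given \<open>X\<close> and \<open>Z\<close> for the untreated trend
  itself.  By no anticipation \<open>\<theta> = E[\<G>\<^sub>1 (\<Delta>Y - Z)] / \<pi>\<^sub>1\<close>, so it has to be shown that the control term
  of \<open>\<phi>\<close> has the same mean as \<open>\<G>\<^sub>1 (Z - m(X))\<close>.  With the true \<open>p\<close>, iterated expectations turn
  \<open>w\<^sub>g p\<^sub>1 / p\<^sub>g \<G>\<^sub>g (Z - m)\<close> into \<open>w\<^sub>g \<G>\<^sub>1 (\<mu>\<^sub>g - m)\<close>, and since the weights sum to one the sum over \<open>g\<close> is
  \<open>\<G>\<^sub>1 (\<Sum>\<^sub>g w\<^sub>g \<mu>\<^sub>g - m) = \<G>\<^sub>1 (\<mu>\<^sub>1 - m)\<close>, under parallel trends as well as under synthetic control.  With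
  the true \<open>m\<^sub>\<Delta>\<close>, parallel trends give \<open>m\<^sub>\<Delta> = \<mu>\<^sub>g\<close> for every \<open>g\<close>, and both terms have mean zero.
\<close>

section \<open>Regression functions, conditioning on an event, and truncation\<close>

text \<open>Along \<open>X\<close> the regression function agrees almost surely with the conditional
  expectation, and \<open>f (X \<omega>)\<close>, being measurable for the sigma-algebra generated
  by \<open>X\<close>, may be moved inside it without changing the mean.\<close>

lemma cond_mean_moment:
  fixes f :: "'x \<Rightarrow> real" and Z :: "'a \<Rightarrow> real"
  assumes P: "prob_space P" and X[measurable]: "X \<in> measurable P N"
    and f[measurable]: "f \<in> borel_measurable N" and Z[measurable]: "Z \<in> borel_measurable P"
    and int: "integrable P (\<lambda>\<omega>. f (X \<omega>) * Z \<omega>)"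
  shows "integrable P (\<lambda>\<omega>. f (X \<omega>) * cond_mean P N X Z (X \<omega>))"
    and "(\<integral>\<omega>. f (X \<omega>) * cond_mean P N X Z (X \<omega>) \<partial>P) = (\<integral>\<omega>. f (X \<omega>) * Z \<omega> \<partial>P)"
proof -
  interpret prob_space P by fact
  let ?F = "vimage_algebra (space P) X N"
  have XS: "X \<in> space P \<rightarrow> space N"
    using measurable_space[OF X] by auto
  have sub: "subalgebra P ?F"
    unfolding subalgebra_def using sets_vimage_algebra2[OF XS] by (auto intro: measurable_sets[OF X])
  interpret finite_measure_subalgebra P ?F
    by unfold_locales (rule sub)
  note [measurable] = cond_mean_spec(1)[OF X, of Z]
  have XF: "X \<in> measurable ?F N"
    by (rule measurable_vimage_algebra1[OF XS])
  have fF: "(\<lambda>\<omega>. f (X \<omega>)) \<in> borel_measurable ?F"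
    by (rule measurable_compose[OF XF f])
  have [measurable]: "real_cond_exp P ?F Z \<in> borel_measurable P"
    by simp
  note eq = cond_mean_spec(2)[OF X, of Z]
  have "integrable P (\<lambda>\<omega>. f (X \<omega>) * cond_mean P N X Z (X \<omega>)) \<longleftrightarrow>
      integrable P (\<lambda>\<omega>. f (X \<omega>) * real_cond_exp P ?F Z \<omega>)"
    using eq by (intro integrable_cong_AE) auto
  then show "integrable P (\<lambda>\<omega>. f (X \<omega>) * cond_mean P N X Z (X \<omega>))"
    using real_cond_exp_intg(1)[OF int fF Z] by simp
  have "(\<integral>\<omega>. f (X \<omega>) * cond_mean P N X Z (X \<omega>) \<partial>P) =
      (\<integral>\<omega>. f (X \<omega>) * real_cond_exp P ?F Z \<omega> \<partial>P)"
    using eq by (intro integral_cong_AE) auto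
  then show "(\<integral>\<omega>. f (X \<omega>) * cond_mean P N X Z (X \<omega>) \<partial>P) = (\<integral>\<omega>. f (X \<omega>) * Z \<omega> \<partial>P)"
    using real_cond_exp_intg(2)[OF int fF Z] by simp
qed

lemma (in finite_measure) moment_uniform_measure:
  fixes f :: "'a \<Rightarrow> real"
  assumes A[measurable]: "A \<in> sets M" and pos: "measure M A > 0"
    and f[measurable]: "f \<in> borel_measurable M"
  shows "integrable (uniform_measure M A) f \<longleftrightarrow> integrable M (\<lambda>\<omega>. indicator A \<omega> * f \<omega>)"
    and "(\<integral>\<omega>. f \<omega> \<partial>uniform_measure M A) = (\<integral>\<omega>. indicator A \<omega> * f \<omega> \<partial>M) / measure M A"
proof -
  \<comment> \<open>Since \<open>measure M A\<close> is finite and positive, the extended-real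
    quotient behind \<open>uniform_measure\<close> is a real density, and integrals against it
    reduce to integrals over \<open>M\<close>.\<close>
  have U: "uniform_measure M A = density M (\<lambda>\<omega>. ennreal (indicator A \<omega> / measure M A))"
    unfolding uniform_measure_def using pos
    by (intro density_cong) (auto simp: emeasure_eq_measure divide_ennreal split: split_indicator
          simp flip: ennreal_1)
  have "integrable (uniform_measure M A) f \<longleftrightarrow>
      integrable M (\<lambda>\<omega>. inverse (measure M A) * (indicator A \<omega> * f \<omega>))"
    unfolding U using pos by (subst integrable_real_density) (auto simp: field_simps)
  also have "\<dots> \<longleftrightarrow> integrable M (\<lambda>\<omega>. indicator A \<omega> * f \<omega>)"
    using pos by simp
  finally show "integrable (uniform_measure M A) f \<longleftrightarrow> integrable M (\<lambda>\<omega>. indicator A \<omega> * f \<omega>)" .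
  have "(\<integral>\<omega>. f \<omega> \<partial>uniform_measure M A) =
      (\<integral>\<omega>. inverse (measure M A) * (indicator A \<omega> * f \<omega>) \<partial>M)"
    unfolding U using pos by (subst integral_real_density) (auto simp: field_simps)
  then show "(\<integral>\<omega>. f \<omega> \<partial>uniform_measure M A) = (\<integral>\<omega>. indicator A \<omega> * f \<omega> \<partial>M) / measure M A"
    by (simp add: field_simps)
qed

text \<open>Moments of the form \<open>\<phi>\<close> can only be split into their summands after truncation, since
  integrability of the sum does not give integrability of the summands.\<close>

lemma integral_eq_if_truncated_integral_eq:
  fixes F F' :: "'a \<Rightarrow> real" and b :: "'a \<Rightarrow> real"
  assumes F: "integrable M F" and F': "integrable M F'" and b[measurable]: "b \<in> borel_measurable M"
    and eq: "\<And>k::nat. (\<integral>\<omega>. of_bool (b \<omega> \<le> real k) * F \<omega> \<partial>M) =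
      (\<integral>\<omega>. of_bool (b \<omega> \<le> real k) * F' \<omega> \<partial>M)"
  shows "integral\<^sup>L M F = integral\<^sup>L M F'"
proof -
  \<comment> \<open>Dominated convergence: the truncated integrands are bounded by
    \<open>\<bar>H \<omega>\<bar>\<close>, and at each point the cutoff equals 1 as soon as
    \<open>k\<close> reaches \<open>b \<omega>\<close>.\<close>
  have lim: "(\<lambda>k. \<integral>\<omega>. of_bool (b \<omega> \<le> real k) * H \<omega> \<partial>M) \<longlonglongrightarrow> integral\<^sup>L M H"
    if H: "integrable M H" for H :: "'a \<Rightarrow> real"
  proof (rule integral_dominated_convergence[where w="\<lambda>\<omega>. \<bar>H \<omega>\<bar>"])
    have [measurable]: "H \<in> borel_measurable M"
      using H by auto
    show "H \<in> borel_measurable M" "(\<lambda>\<omega>. of_bool (b \<omega> \<le> real k) * H \<omega>) \<in> borel_measurable M" for k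
      unfolding of_bool_def by measurable
    show "AE \<omega> in M. (\<lambda>k. of_bool (b \<omega> \<le> real k) * H \<omega>) \<longlonglongrightarrow> H \<omega>"
    proof (rule AE_I2)
      fix \<omega>
      have "\<forall>\<^sub>F k in sequentially. b \<omega> \<le> real k"
        using real_nat_ceiling_ge[of "b \<omega>"]
        by (intro eventually_sequentiallyI[of "nat \<lceil>b \<omega>\<rceil>"]) linarith
      then have "\<forall>\<^sub>F k in sequentially. of_bool (b \<omega> \<le> real k) * H \<omega> = H \<omega>"
        by eventually_elim simp
      then show "(\<lambda>k. of_bool (b \<omega> \<le> real k) * H \<omega>) \<longlonglongrightarrow> H \<omega>"
        by (rule tendsto_eventually)
    qed
  qed (use H in auto)
  show ?thesis
    using LIMSEQ_unique[OF lim[OF F] lim[OF F', folded eq]] .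
qed

text \<open>Residual moments call for a single constant that bounds several functions. An indicator
  is at most 1, a function cut off where its majorant exceeds \<open>k\<close> is at most
  \<open>k\<close>, and \<open>max 1 k\<close> serves for both.\<close>

lemma abs_of_bool_le: "\<bar>of_bool P :: real\<bar> \<le> max 1 k"
  by (simp add: le_max_iff_disj)

lemma abs_of_bool_mult_le:
  fixes f b k :: real
  assumes "\<bar>f\<bar> \<le> b"
  shows "\<bar>of_bool (b \<le> k) * f\<bar> \<le> max 1 k"
  using assms by (cases "b \<le> k") (auto simp: le_max_iff_disj)

section \<open>Group probabilities and group means under overlap\<close>

locale grouped_population = prob_space M for M :: "'a measure" +
  fixes N :: "'x measure" and X :: "'a \<Rightarrow> 'x" and G :: "'a \<Rightarrow> nat" and NG :: nat
  assumes G: "G \<in> measurable M (count_space {1..NG + 1})"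
    and X[measurable]: "X \<in> measurable M N"
    and overlap: "g \<in> {1..NG + 1} \<Longrightarrow> AE \<omega> in M. group_prob M N X G g (X \<omega>) > 0"
begin

lemma group_sets[measurable]: "{\<omega> \<in> space M. G \<omega> \<in> J} \<in> sets M"
proof -
  \<comment> \<open>The target space of \<open>G\<close> is \<open>{1..NG + 1}\<close>, so a set
    such as \<open>- {1}\<close> has to be cut down to it first.\<close>
  have "{\<omega> \<in> space M. G \<omega> \<in> J} = G -` (J \<inter> {1..NG + 1}) \<inter> space M"
    using measurable_space[OF G] by auto
  then show ?thesis
    using measurable_sets[OF G, of "J \<inter> {1..NG + 1}"] by simp
qed

lemma group_indicator[measurable]: "(\<lambda>\<omega>. of_bool (G \<omega> \<in> J) :: real) \<in> borel_measurable M"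
proof -
  have "(\<lambda>\<omega>. indicator {\<omega> \<in> space M. G \<omega> \<in> J} \<omega> :: real) \<in> borel_measurable M"
    by measurable
  then show ?thesis
    by (rule measurable_cong[THEN iffD1, rotated]) (auto simp: indicator_def)
qed

lemma group_indicator_single[measurable]: "(\<lambda>\<omega>. of_bool (G \<omega> = g) :: real) \<in> borel_measurable M"
  using group_indicator[of "{g}"] by simp

lemma group_mean_measurable[measurable]: "group_mean M N X G J Z \<in> borel_measurable N"
  unfolding group_mean_def given_group_def by (rule cond_mean_spec) measurable

lemma group_prob_measurable[measurable]: "group_prob M N X G g \<in> borel_measurable N"
  unfolding group_prob_def by (rule cond_mean_spec) measurable

text \<open>Iterated expectations for the group indicator. Applied forwards for one group and
  backwards for another, this carries a moment between groups.\<close>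

lemma group_prob_moment:
  assumes [measurable]: "f \<in> borel_measurable N"
    and "integrable M (\<lambda>\<omega>. of_bool (G \<omega> = g) * f (X \<omega>))"
  shows "integrable M (\<lambda>\<omega>. group_prob M N X G g (X \<omega>) * f (X \<omega>))"
    and "(\<integral>\<omega>. group_prob M N X G g (X \<omega>) * f (X \<omega>) \<partial>M) = (\<integral>\<omega>. of_bool (G \<omega> = g) * f (X \<omega>) \<partial>M)"
  using cond_mean_moment[OF prob_space_axioms X assms(1) group_indicator_single[of g]] assms(2)
  by (simp_all add: group_prob_def mult.commute)

text \<open>If \<open>X\<close> avoids \<open>A\<close> on group \<open>g\<close>, then
  \<open>p\<^sub>g(X)\<close> times the indicator of \<open>A\<close> has mean zero; as
  \<open>p\<^sub>g(X)\<close> is positive by overlap, \<open>X\<close> avoids \<open>A\<close> in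
  the whole population. Group means are pinned down only on their group, and this extends equalities
  between them to almost every \<open>X \<omega>\<close>.\<close>

lemma AE_covariate_if_AE_on_group:
  assumes g: "g \<in> {1..NG + 1}" and A[measurable]: "A \<in> sets N"
    and AE: "AE \<omega> in M. G \<omega> = g \<longrightarrow> X \<omega> \<notin> A"
  shows "AE \<omega> in M. X \<omega> \<notin> A"
proof -
  let ?p = "group_prob M N X G g" and ?f = "indicator A :: 'x \<Rightarrow> real"
  have int: "integrable M (\<lambda>\<omega>. of_bool (G \<omega> = g) * ?f (X \<omega>))"
    by (rule integrable_const_bound[where B=1]) (auto simp: indicator_def)
  have "(\<integral>\<omega>. ?p (X \<omega>) * ?f (X \<omega>) \<partial>M) = (\<integral>\<omega>. of_bool (G \<omega> = g) * ?f (X \<omega>) \<partial>M)"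
    by (rule group_prob_moment[OF _ int]) measurable
  also have "\<dots> = (\<integral>\<omega>. 0 \<partial>M)"
    using AE by (intro integral_cong_AE) (auto simp: indicator_def)
  finally have "(\<integral>\<omega>. ?p (X \<omega>) * ?f (X \<omega>) \<partial>M) = 0"
    by simp
  moreover have "AE \<omega> in M. 0 \<le> ?p (X \<omega>) * ?f (X \<omega>)"
    using overlap[OF g] by eventually_elim (simp add: indicator_def)
  ultimately have "AE \<omega> in M. ?p (X \<omega>) * ?f (X \<omega>) = 0"
    using integral_nonneg_eq_0_iff_AE[OF group_prob_moment(1)[OF _ int]] by simp
  then show ?thesis
    using overlap[OF g] by eventually_elim (auto simp: indicator_def)
qed

text \<open>On a null group every claim about \<open>X\<close> holds vacuously, even that
  \<open>X\<close> avoids \<open>space N\<close>. The previous lemma would spread this claim to the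
  whole population, where it is absurd.\<close>

lemma group_pos:
  assumes g: "g \<in> {1..NG + 1}" and J: "g \<in> J"
  shows "measure M {\<omega> \<in> space M. G \<omega> \<in> J} > 0"
proof (rule ccontr)
  assume "\<not> ?thesis"
  then have "measure M {\<omega> \<in> space M. G \<omega> \<in> J} = 0"
    by (simp add: not_less measure_le_0_iff)
  then have "AE \<omega> in M. \<not> (G \<omega> \<in> J)"
    using prob_eq_0[OF group_sets[of J]] by (auto elim: AE_mp)
  then have "AE \<omega> in M. G \<omega> = g \<longrightarrow> X \<omega> \<notin> space N"
    using J by (auto elim!: AE_mp)
  then have "AE \<omega> in M. X \<omega> \<notin> space N"
    by (rule AE_covariate_if_AE_on_group[OF g sets.top])
  then have "AE \<omega> in M. False"
    using AE_space by eventually_elim (use measurable_space[OF X] in auto)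
  then show False
    by simp
qed

lemma given_group_moment:
  fixes f :: "'a \<Rightarrow> real"
  assumes g: "g \<in> {1..NG + 1}" "g \<in> J" and [measurable]: "f \<in> borel_measurable M"
  shows "integrable (given_group M G J) f \<longleftrightarrow> integrable M (\<lambda>\<omega>. of_bool (G \<omega> \<in> J) * f \<omega>)"
    and "(\<integral>\<omega>. f \<omega> \<partial>given_group M G J) =
      (\<integral>\<omega>. of_bool (G \<omega> \<in> J) * f \<omega> \<partial>M) / measure M {\<omega> \<in> space M. G \<omega> \<in> J}"
proof -
  have eq: "indicator {\<omega> \<in> space M. G \<omega> \<in> J} \<omega> * f \<omega> = of_bool (G \<omega> \<in> J) * f \<omega>"
    if "\<omega> \<in> space M" for \<omega>
    using that by (simp add: indicator_def)
  show "integrable (given_group M G J) f \<longleftrightarrow> integrable M (\<lambda>\<omega>. of_bool (G \<omega> \<in> J) * f \<omega>)"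
    unfolding given_group_def moment_uniform_measure(1)[OF group_sets group_pos[OF g] assms(3)]
    by (intro Bochner_Integration.integrable_cong eq refl)
  show "(\<integral>\<omega>. f \<omega> \<partial>given_group M G J) =
      (\<integral>\<omega>. of_bool (G \<omega> \<in> J) * f \<omega> \<partial>M) / measure M {\<omega> \<in> space M. G \<omega> \<in> J}"
    unfolding given_group_def moment_uniform_measure(2)[OF group_sets group_pos[OF g] assms(3)]
    by (intro arg_cong2[where f="(/)"] Bochner_Integration.integral_cong eq refl)
qed

text \<open>This is \<open>cond_mean_moment\<close> under the conditioned measure; both sides carry
  the same normalizing factor, which cancels because \<open>G \<omega> \<in> J\<close> has positive
  probability.\<close>

lemma group_mean_moment:
  fixes f :: "'x \<Rightarrow> real" and Z :: "'a \<Rightarrow> real"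
  assumes g: "g \<in> {1..NG + 1}" "g \<in> J"
    and f[measurable]: "f \<in> borel_measurable N" and Z[measurable]: "Z \<in> borel_measurable M"
    and int: "integrable M (\<lambda>\<omega>. of_bool (G \<omega> \<in> J) * (f (X \<omega>) * Z \<omega>))"
  shows "integrable M (\<lambda>\<omega>. of_bool (G \<omega> \<in> J) * (f (X \<omega>) * group_mean M N X G J Z (X \<omega>)))"
    and "(\<integral>\<omega>. of_bool (G \<omega> \<in> J) * (f (X \<omega>) * group_mean M N X G J Z (X \<omega>)) \<partial>M) =
      (\<integral>\<omega>. of_bool (G \<omega> \<in> J) * (f (X \<omega>) * Z \<omega>) \<partial>M)"
proof -
  let ?P = "given_group M G J"
  have pos: "measure M {\<omega> \<in> space M. G \<omega> \<in> J} > 0"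
    by (rule group_pos[OF g])
  have P: "prob_space ?P"
    unfolding given_group_def using pos
    by (intro prob_space_uniform_measure) (auto simp: emeasure_eq_measure)
  have [simp, measurable_cong]: "sets ?P = sets M"
    by (simp add: given_group_def)
  have XP: "X \<in> measurable ?P N" and ZP: "Z \<in> borel_measurable ?P"
    by measurable
  have intP: "integrable ?P (\<lambda>\<omega>. f (X \<omega>) * Z \<omega>)"
    using int by (subst given_group_moment[OF g]) auto
  note P_moment = cond_mean_moment[OF P XP f ZP intP, folded group_mean_def]
  show "integrable M (\<lambda>\<omega>. of_bool (G \<omega> \<in> J) * (f (X \<omega>) * group_mean M N X G J Z (X \<omega>)))"
    using P_moment(1) by (subst (asm) given_group_moment[OF g]) auto
  show "(\<integral>\<omega>. of_bool (G \<omega> \<in> J) * (f (X \<omega>) * group_mean M N X G J Z (X \<omega>)) \<partial>M) =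
      (\<integral>\<omega>. of_bool (G \<omega> \<in> J) * (f (X \<omega>) * Z \<omega>) \<partial>M)"
    using P_moment(2) pos by (subst (asm) (1 2) given_group_moment[OF g]) auto
qed

lemma integrable_group_mult_bounded:
  fixes f :: "'x \<Rightarrow> real" and Z :: "'a \<Rightarrow> real"
  assumes [measurable]: "f \<in> borel_measurable N" and Z: "integrable M Z" and f: "\<And>x. \<bar>f x\<bar> \<le> c"
  shows "integrable M (\<lambda>\<omega>. of_bool (G \<omega> \<in> J) * (f (X \<omega>) * Z \<omega>))"
proof (rule Bochner_Integration.integrable_bound)
  show "integrable M (\<lambda>\<omega>. c * Z \<omega>)"
    using Z by simp
  have [measurable]: "Z \<in> borel_measurable M"
    using Z by auto
  show "(\<lambda>\<omega>. of_bool (G \<omega> \<in> J) * (f (X \<omega>) * Z \<omega>)) \<in> borel_measurable M"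
    by measurable
  have "norm (of_bool (G \<omega> \<in> J) * (f (X \<omega>) * Z \<omega>)) \<le> norm (c * Z \<omega>)" for \<omega>
    using mult_right_mono[OF f[of "X \<omega>"], of "\<bar>Z \<omega>\<bar>"]
      mult_right_mono[OF abs_ge_self[of c], of "\<bar>Z \<omega>\<bar>"]
    by (auto simp: abs_mult)
  then show "AE \<omega> in M. norm (of_bool (G \<omega> \<in> J) * (f (X \<omega>) * Z \<omega>)) \<le> norm (c * Z \<omega>)"
    by simp
qed

text \<open>Testing with the sign of the difference between the group mean and \<open>h\<close>
  shows that the absolute difference has mean zero on \<open>J\<close>, so the two agree on group
  \<open>g\<close>; overlap extends this to all of \<open>M\<close>.\<close>

lemma group_mean_unique:
  fixes h :: "'x \<Rightarrow> real" and Z :: "'a \<Rightarrow> real"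
  assumes g: "g \<in> {1..NG + 1}" "g \<in> J"
    and h[measurable]: "h \<in> borel_measurable N" and Z: "integrable M Z"
    and hint: "integrable M (\<lambda>\<omega>. of_bool (G \<omega> \<in> J) * h (X \<omega>))"
    and eq: "\<And>f. f \<in> borel_measurable N \<Longrightarrow> (\<And>x. \<bar>f x\<bar> \<le> 1) \<Longrightarrow>
      (\<integral>\<omega>. of_bool (G \<omega> \<in> J) * (f (X \<omega>) * Z \<omega>) \<partial>M) =
      (\<integral>\<omega>. of_bool (G \<omega> \<in> J) * (f (X \<omega>) * h (X \<omega>)) \<partial>M)"
  shows "AE \<omega> in M. group_mean M N X G J Z (X \<omega>) = h (X \<omega>)"
proof -
  let ?m = "group_mean M N X G J Z"
  define f where "f x = sgn (?m x - h x)" for x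
  have [measurable]: "f \<in> borel_measurable N" "Z \<in> borel_measurable M"
    unfolding f_def using Z by auto
  have f1: "\<bar>f x\<bar> \<le> 1" for x
    by (simp add: f_def sgn_real_def)
  have Zint: "integrable M (\<lambda>\<omega>. of_bool (G \<omega> \<in> J) * (f (X \<omega>) * Z \<omega>))"
    by (rule integrable_group_mult_bounded[OF _ Z f1]) measurable
  note m = group_mean_moment[OF g _ _ Zint]
  \<comment> \<open>The indicator is inserted twice, so that the integrable function in
    \<open>hint\<close> plays the role of \<open>Z\<close>; being idempotent, it collapses again in
    the next step.\<close>
  have "integrable M (\<lambda>\<omega>. of_bool (G \<omega> \<in> J) * (f (X \<omega>) * (of_bool (G \<omega> \<in> J) * h (X \<omega>))))"
    by (rule integrable_group_mult_bounded[OF _ hint f1]) measurable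
  then have fh: "integrable M (\<lambda>\<omega>. of_bool (G \<omega> \<in> J) * (f (X \<omega>) * h (X \<omega>)))"
    by (rule Bochner_Integration.integrable_cong[THEN iffD1, rotated -1]) auto
  have split: "of_bool (G \<omega> \<in> J) * \<bar>?m (X \<omega>) - h (X \<omega>)\<bar> =
      of_bool (G \<omega> \<in> J) * (f (X \<omega>) * ?m (X \<omega>)) - of_bool (G \<omega> \<in> J) * (f (X \<omega>) * h (X \<omega>))" for \<omega>
    by (auto simp: f_def abs_real_def sgn_real_def)
  have "(\<integral>\<omega>. of_bool (G \<omega> \<in> J) * \<bar>?m (X \<omega>) - h (X \<omega>)\<bar> \<partial>M) = 0"
    unfolding split using m fh eq[of f] f1 by simp
  moreover have "integrable M (\<lambda>\<omega>. of_bool (G \<omega> \<in> J) * \<bar>?m (X \<omega>) - h (X \<omega>)\<bar>)"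
    unfolding split using m fh by simp
  ultimately have "AE \<omega> in M. of_bool (G \<omega> \<in> J) * \<bar>?m (X \<omega>) - h (X \<omega>)\<bar> = 0"
    by (subst (asm) integral_nonneg_eq_0_iff_AE) auto
  then have "AE \<omega> in M. G \<omega> = g \<longrightarrow> X \<omega> \<notin> {x \<in> space N. ?m x \<noteq> h x}"
    by eventually_elim (use g in auto)
  then have "AE \<omega> in M. X \<omega> \<notin> {x \<in> space N. ?m x \<noteq> h x}"
    by (rule AE_covariate_if_AE_on_group[OF g(1), rotated]) measurable
  then show ?thesis
    using AE_space by eventually_elim (use measurable_space[OF X] in auto)
qed

text \<open>Both sides have the same moments against bounded functions of \<open>X\<close>, so
  uniqueness applies. Synthetic control speaks of levels and the estimand of trends; this passes
  from one to the other.\<close>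

lemma group_mean_diff:
  assumes g: "g \<in> {1..NG + 1}" "g \<in> J" and Z: "integrable M Z" and Z': "integrable M Z'"
  shows "AE \<omega> in M. group_mean M N X G J (\<lambda>\<omega>. Z \<omega> - Z' \<omega>) (X \<omega>) =
    group_mean M N X G J Z (X \<omega>) - group_mean M N X G J Z' (X \<omega>)"
proof (rule group_mean_unique[OF g])
  have [measurable]: "Z \<in> borel_measurable M" "Z' \<in> borel_measurable M"
    using Z Z' by auto
  note int = integrable_group_mult_bounded[OF _ Z] integrable_group_mult_bounded[OF _ Z']
  have "integrable M (\<lambda>\<omega>. of_bool (G \<omega> \<in> J) * ((\<lambda>_. 1) (X \<omega>) * W \<omega>))"
    if "integrable M W" for W :: "'a \<Rightarrow> real"
    by (rule integrable_group_mult_bounded[OF _ that, where c=1]) auto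
  from group_mean_moment(1)[OF g _ _ this[OF Z]] group_mean_moment(1)[OF g _ _ this[OF Z']]
  show "integrable M (\<lambda>\<omega>. of_bool (G \<omega> \<in> J) *
      (group_mean M N X G J Z (X \<omega>) - group_mean M N X G J Z' (X \<omega>)))"
    by (simp add: right_diff_distrib)
  fix f :: "'x \<Rightarrow> real"
  assume f: "f \<in> borel_measurable N" "\<And>x. \<bar>f x\<bar> \<le> 1"
  note f_int = int[OF f] and m = group_mean_moment[OF g f(1) _ int(1)[OF f]]
    group_mean_moment[OF g f(1) _ int(2)[OF f]]
  show "(\<integral>\<omega>. of_bool (G \<omega> \<in> J) * (f (X \<omega>) * (Z \<omega> - Z' \<omega>)) \<partial>M) =
      (\<integral>\<omega>. of_bool (G \<omega> \<in> J) * (f (X \<omega>) *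
        (group_mean M N X G J Z (X \<omega>) - group_mean M N X G J Z' (X \<omega>))) \<partial>M)"
    using f_int m by (simp add: right_diff_distrib)
qed (use Z Z' in auto)


section \<open>Residual moments within a group and their transfer to group 1\<close>

lemma group_range: "\<omega> \<in> space M \<Longrightarrow> G \<omega> \<in> {1..NG + 1}"
  using measurable_space[OF G] by auto

text \<open>As \<open>m\<close> is an arbitrary measurable function, the bound is put on
  \<open>r * m\<close>. The residual then splits into two integrable pieces, and iterated
  expectations change only the one that contains \<open>Z\<close>.\<close>

lemma group_residual_moment:
  fixes r m :: "'x \<Rightarrow> real" and Z :: "'a \<Rightarrow> real"
  assumes g: "g \<in> {1..NG + 1}" and [measurable]: "r \<in> borel_measurable N" "m \<in> borel_measurable N"
    and Z: "integrable M Z" and r: "\<And>x. \<bar>r x\<bar> \<le> c" and rm: "\<And>x. \<bar>r x * m x\<bar> \<le> c"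
  shows "integrable M (\<lambda>\<omega>. of_bool (G \<omega> = g) * (r (X \<omega>) * (Z \<omega> - m (X \<omega>))))"
    and "integrable M (\<lambda>\<omega>. of_bool (G \<omega> = g) * (r (X \<omega>) * (group_mean M N X G {g} Z (X \<omega>) - m (X \<omega>))))"
    and "(\<integral>\<omega>. of_bool (G \<omega> = g) * (r (X \<omega>) * (Z \<omega> - m (X \<omega>))) \<partial>M) =
      (\<integral>\<omega>. of_bool (G \<omega> = g) * (r (X \<omega>) * (group_mean M N X G {g} Z (X \<omega>) - m (X \<omega>))) \<partial>M)"
proof -
  have [measurable]: "Z \<in> borel_measurable M"
    using Z by auto
  have rZ: "integrable M (\<lambda>\<omega>. of_bool (G \<omega> \<in> {g}) * (r (X \<omega>) * Z \<omega>))"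
    by (rule integrable_group_mult_bounded[OF _ Z r]) measurable
  \<comment> \<open>Here \<open>r * m\<close> is the bounded factor and the constant 1 the
    integrable one.\<close>
  have "integrable M (\<lambda>\<omega>. of_bool (G \<omega> \<in> {g}) * ((r (X \<omega>) * m (X \<omega>)) * 1))"
    by (rule integrable_group_mult_bounded[OF _ _ rm]) auto
  note int = rZ this group_mean_moment[OF g singletonI _ _ rZ]
  show "integrable M (\<lambda>\<omega>. of_bool (G \<omega> = g) * (r (X \<omega>) * (Z \<omega> - m (X \<omega>))))"
    and "integrable M (\<lambda>\<omega>. of_bool (G \<omega> = g) * (r (X \<omega>) * (group_mean M N X G {g} Z (X \<omega>) - m (X \<omega>))))"
    and "(\<integral>\<omega>. of_bool (G \<omega> = g) * (r (X \<omega>) * (Z \<omega> - m (X \<omega>))) \<partial>M) =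
      (\<integral>\<omega>. of_bool (G \<omega> = g) * (r (X \<omega>) * (group_mean M N X G {g} Z (X \<omega>) - m (X \<omega>))) \<partial>M)"
    using int by (simp_all add: right_diff_distrib)
qed

text \<open>The factor \<open>p\<^sub>1 / p\<^sub>g\<close> carries group \<open>g\<close>'s covariate distribution over to group 1's.\<close>

lemma reweighted_residual_moment:
  fixes r m :: "'x \<Rightarrow> real" and Z :: "'a \<Rightarrow> real"
  defines "\<mu> \<equiv> \<lambda>g. group_mean M N X G {g} Z" and "p \<equiv> group_prob M N X G"
  assumes g: "g \<in> {1..NG + 1}" and [measurable]: "r \<in> borel_measurable N" "m \<in> borel_measurable N"
    and Z: "integrable M Z"
    and bounds: "\<And>x. \<bar>r x * (p 1 x / p g x)\<bar> \<le> c" "\<And>x. \<bar>r x * (p 1 x / p g x) * m x\<bar> \<le> c"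
      "\<And>x. \<bar>r x * (\<mu> g x - m x)\<bar> \<le> c"
  shows "integrable M (\<lambda>\<omega>. of_bool (G \<omega> = 1) * (r (X \<omega>) * (\<mu> g (X \<omega>) - m (X \<omega>))))"
    and "(\<integral>\<omega>. of_bool (G \<omega> = g) * (r (X \<omega>) * (p 1 (X \<omega>) / p g (X \<omega>)) * (Z \<omega> - m (X \<omega>))) \<partial>M) =
      (\<integral>\<omega>. of_bool (G \<omega> = 1) * (r (X \<omega>) * (\<mu> g (X \<omega>) - m (X \<omega>))) \<partial>M)"
proof -
  have [measurable]: "\<mu> g \<in> borel_measurable N" "p g \<in> borel_measurable N" for g
    unfolding \<mu>_def p_def by measurable
  have \<mu>_eq: "group_mean M N X G {g} Z = \<mu> g" for g
    by (simp add: \<mu>_def)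
  let ?d = "\<lambda>x. r x * (\<mu> g x - m x)" and ?a = "\<lambda>x. r x * (p 1 x / p g x)"
  have d1: "integrable M (\<lambda>\<omega>. of_bool (G \<omega> = 1) * ?d (X \<omega>))"
    using integrable_group_mult_bounded[of ?d "\<lambda>_. 1" c "{1}"] bounds(3) by simp
  then show "integrable M (\<lambda>\<omega>. of_bool (G \<omega> = 1) * ?d (X \<omega>))" .
  have meas: "?a \<in> borel_measurable N"
    by measurable
  note res = group_residual_moment[OF g meas \<open>m \<in> borel_measurable N\<close> Z bounds(1,2), unfolded \<mu>_eq]
  have "(\<integral>\<omega>. of_bool (G \<omega> = g) * (?a (X \<omega>) * (Z \<omega> - m (X \<omega>))) \<partial>M) =
      (\<integral>\<omega>. of_bool (G \<omega> = g) * (?a (X \<omega>) * (\<mu> g (X \<omega>) - m (X \<omega>))) \<partial>M)"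
    by (rule res(3))
  \<comment> \<open>What remains beside the indicator depends on \<open>X\<close> alone, so the
    indicator of group \<open>g\<close> becomes \<open>p g\<close>. By overlap it cancels the
    denominator, and the surviving \<open>p 1\<close> turns back into the indicator of group
    1.\<close>
  also have "\<dots> = (\<integral>\<omega>. p g (X \<omega>) * (?a (X \<omega>) * (\<mu> g (X \<omega>) - m (X \<omega>))) \<partial>M)"
    unfolding p_def
    by (rule group_prob_moment(2)[symmetric, where f="\<lambda>x. ?a x * (\<mu> g x - m x)", unfolded p_def])
      (measurable, rule res(2)[unfolded p_def])
  also have "\<dots> = (\<integral>\<omega>. p 1 (X \<omega>) * ?d (X \<omega>) \<partial>M)"
    using overlap[OF g, folded p_def] by (intro integral_cong_AE) (measurable, auto)
  also have "\<dots> = (\<integral>\<omega>. of_bool (G \<omega> = 1) * ?d (X \<omega>) \<partial>M)"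
    unfolding p_def by (rule group_prob_moment(2)[OF _ d1]) measurable
  finally show "(\<integral>\<omega>. of_bool (G \<omega> = g) * (?a (X \<omega>) * (Z \<omega> - m (X \<omega>))) \<partial>M) =
      (\<integral>\<omega>. of_bool (G \<omega> = 1) * ?d (X \<omega>) \<partial>M)" .
qed

section \<open>The contrast between group 1 and the weighted control groups\<close>

text \<open>The cutoff depends on \<open>X\<close> only and is therefore compatible with
  conditioning on \<open>X\<close>. Where \<open>B\<close> is at most \<open>k\<close>, all summands
  are integrable and the contrast splits; \<open>balance\<close> exchanges the control terms for the
  group 1 residual of \<open>Z\<close>, \<open>m\<close> cancels, and \<open>D - Z\<close> is left.
  Letting \<open>k\<close> grow removes the cutoff.\<close>

lemma contrast_moment:
  fixes D Z :: "'a \<Rightarrow> real" and a :: "nat \<Rightarrow> 'x \<Rightarrow> real" and m B :: "'x \<Rightarrow> real"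
  assumes D: "integrable M D" and Z: "integrable M Z" and DZ: "\<And>\<omega>. G \<omega> \<noteq> 1 \<Longrightarrow> D \<omega> = Z \<omega>"
    and a[measurable]: "\<And>h. h \<in> {2..NG + 1} \<Longrightarrow> a h \<in> borel_measurable N"
    and [measurable]: "m \<in> borel_measurable N" "B \<in> borel_measurable N"
    and bounds: "\<And>x. \<bar>m x\<bar> \<le> B x" "\<And>x h. h \<in> {2..NG + 1} \<Longrightarrow> \<bar>a h x\<bar> \<le> B x"
      "\<And>x h. h \<in> {2..NG + 1} \<Longrightarrow> \<bar>a h x * m x\<bar> \<le> B x"
    and int: "integrable M (\<lambda>\<omega>. (of_bool (G \<omega> = 1) - (\<Sum>h = 2..NG + 1. a h (X \<omega>) * of_bool (G \<omega> = h))) *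
      (D \<omega> - m (X \<omega>)))"
    and balance: "\<And>k::nat.
      (\<Sum>h = 2..NG + 1. \<integral>\<omega>. of_bool (G \<omega> = h) *
        (of_bool (B (X \<omega>) \<le> k) * a h (X \<omega>) * (Z \<omega> - m (X \<omega>))) \<partial>M) =
      (\<integral>\<omega>. of_bool (G \<omega> = 1) * (of_bool (B (X \<omega>) \<le> k) * (Z \<omega> - m (X \<omega>))) \<partial>M)"
  shows "(\<integral>\<omega>. (of_bool (G \<omega> = 1) - (\<Sum>h = 2..NG + 1. a h (X \<omega>) * of_bool (G \<omega> = h))) *
      (D \<omega> - m (X \<omega>)) \<partial>M) = (\<integral>\<omega>. of_bool (G \<omega> = 1) * (D \<omega> - Z \<omega>) \<partial>M)"
proof (rule integral_eq_if_truncated_integral_eq[OF int, where b="\<lambda>\<omega>. B (X \<omega>)"])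
  show "integrable M (\<lambda>\<omega>. of_bool (G \<omega> = 1) * (D \<omega> - Z \<omega>))"
    using integrable_group_mult_bounded[of "\<lambda>_. 1" "\<lambda>\<omega>. D \<omega> - Z \<omega>" 1 "{1}"] D Z by simp
  show "(\<lambda>\<omega>. B (X \<omega>)) \<in> borel_measurable M"
    by measurable
  fix k :: nat
  let ?\<chi> = "\<lambda>x. of_bool (B x \<le> real k) :: real"
  have \<chi>[measurable]: "?\<chi> \<in> borel_measurable N"
    unfolding of_bool_def by measurable
  have cut: "\<bar>?\<chi> x * f\<bar> \<le> real k" if "\<bar>f\<bar> \<le> B x" for x f
    using that by simp
  have \<chi>le: "\<bar>?\<chi> x\<bar> \<le> max 1 (real k)" and \<chi>m: "\<bar>?\<chi> x * m x\<bar> \<le> max 1 (real k)" for x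
    using cut[OF bounds(1), of x] by auto
  have one: "1 \<in> {1..NG + 1}"
    by simp
  note D1 = group_residual_moment[OF one \<chi> \<open>m \<in> _\<close> D \<chi>le \<chi>m]
    and Z1 = group_residual_moment[OF one \<chi> \<open>m \<in> _\<close> Z \<chi>le \<chi>m]
  have ah: "integrable M (\<lambda>\<omega>. of_bool (G \<omega> = h) * (?\<chi> (X \<omega>) * a h (X \<omega>) * (Z \<omega> - m (X \<omega>))))"
    if h: "h \<in> {2..NG + 1}" for h
  proof (rule group_residual_moment(1)[OF _ _ \<open>m \<in> _\<close> Z])
    show "(\<lambda>x. ?\<chi> x * a h x) \<in> borel_measurable N"
      using h by measurable
    show "\<bar>?\<chi> x * a h x\<bar> \<le> real k" "\<bar>?\<chi> x * a h x * m x\<bar> \<le> real k" for x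
      using cut[OF bounds(2)[OF h], of x] cut[OF bounds(3)[OF h], of x] by (simp_all add: mult.assoc)
  qed (use h in auto)
  \<comment> \<open>A control summand lives on a group \<open>h \<ge> 2\<close>, where
    \<open>D\<close> and \<open>Z\<close> coincide; only the group 1 term retains
    \<open>D\<close>.\<close>
  have split: "?\<chi> (X \<omega>) * ((of_bool (G \<omega> = 1) - (\<Sum>h = 2..NG + 1. a h (X \<omega>) * of_bool (G \<omega> = h))) *
        (D \<omega> - m (X \<omega>))) =
      of_bool (G \<omega> = 1) * (?\<chi> (X \<omega>) * (D \<omega> - m (X \<omega>))) -
      (\<Sum>h = 2..NG + 1. of_bool (G \<omega> = h) * (?\<chi> (X \<omega>) * a h (X \<omega>) * (Z \<omega> - m (X \<omega>))))" for \<omega>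
  proof -
    have "of_bool (G \<omega> = h) * (?\<chi> (X \<omega>) * a h (X \<omega>) * (Z \<omega> - m (X \<omega>))) =
        ?\<chi> (X \<omega>) * (D \<omega> - m (X \<omega>)) * (a h (X \<omega>) * of_bool (G \<omega> = h))" if "h \<in> {2..NG + 1}" for h
      using that DZ[of \<omega>] by auto
    then have "(\<Sum>h = 2..NG + 1. of_bool (G \<omega> = h) * (?\<chi> (X \<omega>) * a h (X \<omega>) * (Z \<omega> - m (X \<omega>)))) =
        ?\<chi> (X \<omega>) * (D \<omega> - m (X \<omega>)) * (\<Sum>h = 2..NG + 1. a h (X \<omega>) * of_bool (G \<omega> = h))"
      unfolding sum_distrib_left by (intro sum.cong refl)
    then show ?thesis
      by (simp only: algebra_simps)
  qed
  have "(\<integral>\<omega>. ?\<chi> (X \<omega>) * ((of_bool (G \<omega> = 1) - (\<Sum>h = 2..NG + 1. a h (X \<omega>) * of_bool (G \<omega> = h))) *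
        (D \<omega> - m (X \<omega>))) \<partial>M) =
      (\<integral>\<omega>. of_bool (G \<omega> = 1) * (?\<chi> (X \<omega>) * (D \<omega> - m (X \<omega>))) \<partial>M) -
      (\<integral>\<omega>. of_bool (G \<omega> = 1) * (?\<chi> (X \<omega>) * (Z \<omega> - m (X \<omega>))) \<partial>M)"
    unfolding split balance[symmetric]
    by (subst Bochner_Integration.integral_diff, rule D1(1), rule Bochner_Integration.integrable_sum,
        erule ah, subst Bochner_Integration.integral_sum, erule ah, rule refl)
  also have "\<dots> = (\<integral>\<omega>. ?\<chi> (X \<omega>) * (of_bool (G \<omega> = 1) * (D \<omega> - Z \<omega>)) \<partial>M)"
    using D1(1) Z1(1)
    by (subst Bochner_Integration.integral_diff[symmetric])
      (auto intro!: Bochner_Integration.integral_cong simp: algebra_simps)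
  finally show "(\<integral>\<omega>. ?\<chi> (X \<omega>) * ((of_bool (G \<omega> = 1) -
        (\<Sum>h = 2..NG + 1. a h (X \<omega>) * of_bool (G \<omega> = h))) * (D \<omega> - m (X \<omega>))) \<partial>M) =
      (\<integral>\<omega>. ?\<chi> (X \<omega>) * (of_bool (G \<omega> = 1) * (D \<omega> - Z \<omega>)) \<partial>M)" .
qed

text \<open>With \<open>m\<close> equal to every group mean, each truncated residual has mean zero
  whatever its coefficient, so both sides of \<open>balance\<close> vanish.\<close>

lemma contrast_moment_true_regression:
  fixes D Z :: "'a \<Rightarrow> real" and a :: "nat \<Rightarrow> 'x \<Rightarrow> real" and m :: "'x \<Rightarrow> real"
  assumes D: "integrable M D" and Z: "integrable M Z" and DZ: "\<And>\<omega>. G \<omega> \<noteq> 1 \<Longrightarrow> D \<omega> = Z \<omega>"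
    and a[measurable]: "\<And>h. h \<in> {2..NG + 1} \<Longrightarrow> a h \<in> borel_measurable N"
    and m[measurable]: "m \<in> borel_measurable N"
    and int: "integrable M (\<lambda>\<omega>. (of_bool (G \<omega> = 1) - (\<Sum>h = 2..NG + 1. a h (X \<omega>) * of_bool (G \<omega> = h))) *
      (D \<omega> - m (X \<omega>)))"
    and regression: "\<And>g. g \<in> {1..NG + 1} \<Longrightarrow> AE \<omega> in M. m (X \<omega>) = group_mean M N X G {g} Z (X \<omega>)"
  shows "(\<integral>\<omega>. (of_bool (G \<omega> = 1) - (\<Sum>h = 2..NG + 1. a h (X \<omega>) * of_bool (G \<omega> = h))) *
      (D \<omega> - m (X \<omega>)) \<partial>M) = (\<integral>\<omega>. of_bool (G \<omega> = 1) * (D \<omega> - Z \<omega>) \<partial>M)"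
proof -
  \<comment> \<open>A sum of absolute values dominates each summand, so one cutoff controls
    \<open>m\<close>, all \<open>a h\<close> and all \<open>a h * m\<close> together.\<close>
  let ?B = "\<lambda>x. \<bar>m x\<bar> + (\<Sum>h = 2..NG + 1. \<bar>a h x\<bar> + \<bar>a h x * m x\<bar>)"
  have B: "?B \<in> borel_measurable N"
    by measurable
  have bounds: "\<bar>m x\<bar> \<le> ?B x" for x
    by (simp add: sum_nonneg)
  have bounds_h: "\<bar>a h x\<bar> \<le> ?B x" "\<bar>a h x * m x\<bar> \<le> ?B x" if "h \<in> {2..NG + 1}" for x h
    using member_le_sum[of h "{2..NG + 1}" "\<lambda>h. \<bar>a h x\<bar> + \<bar>a h x * m x\<bar>"] that by auto
  have zero: "(\<integral>\<omega>. of_bool (G \<omega> = g) * (r (X \<omega>) * (Z \<omega> - m (X \<omega>))) \<partial>M) = 0"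
    if g: "g \<in> {1..NG + 1}" and r[measurable]: "r \<in> borel_measurable N"
      and le: "\<And>x. \<bar>r x\<bar> \<le> c" "\<And>x. \<bar>r x * m x\<bar> \<le> c" for g r c
  proof -
    have "(\<integral>\<omega>. of_bool (G \<omega> = g) * (r (X \<omega>) * (group_mean M N X G {g} Z (X \<omega>) - m (X \<omega>))) \<partial>M) =
        (\<integral>\<omega>. 0 \<partial>M)"
      using regression[OF g] by (intro integral_cong_AE) (measurable, auto)
    then show ?thesis
      using group_residual_moment(3)[OF g r m Z le] by simp
  qed
  show ?thesis
  proof (rule contrast_moment[where B="?B", OF D Z DZ a m B bounds bounds_h int])
    fix k :: nat
    let ?\<chi> = "\<lambda>x. of_bool (?B x \<le> real k) :: real"
    have \<chi>[measurable]: "?\<chi> \<in> borel_measurable N"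
      unfolding of_bool_def using B by measurable
    have cut: "\<bar>?\<chi> x * f\<bar> \<le> max 1 (real k)" if "\<bar>f\<bar> \<le> ?B x" for x f
      using that by (rule abs_of_bool_mult_le)
    have "(\<integral>\<omega>. of_bool (G \<omega> = h) * (?\<chi> (X \<omega>) * a h (X \<omega>) * (Z \<omega> - m (X \<omega>))) \<partial>M) = 0"
      if h: "h \<in> {2..NG + 1}" for h
    proof (rule zero[of h "\<lambda>x. ?\<chi> x * a h x"])
      show "(\<lambda>x. ?\<chi> x * a h x) \<in> borel_measurable N"
        using h by measurable
      show "\<bar>?\<chi> x * a h x\<bar> \<le> max 1 (real k)" "\<bar>?\<chi> x * a h x * m x\<bar> \<le> max 1 (real k)" for x
        using cut[OF bounds_h(1)[OF h], of x] cut[OF bounds_h(2)[OF h], of x] by (simp_all only: mult.assoc)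
    qed (use h in auto)
    moreover have "(\<integral>\<omega>. of_bool (G \<omega> = 1) * (?\<chi> (X \<omega>) * (Z \<omega> - m (X \<omega>))) \<partial>M) = 0"
    proof (rule zero[of 1 "?\<chi>"])
      show "\<bar>?\<chi> x\<bar> \<le> max 1 (real k)" "\<bar>?\<chi> x * m x\<bar> \<le> max 1 (real k)" for x
        by (rule abs_of_bool_le, rule cut[OF bounds])
    qed (simp, rule \<chi>)
    ultimately show "(\<Sum>h = 2..NG + 1. \<integral>\<omega>. of_bool (G \<omega> = h) *
        (?\<chi> (X \<omega>) * a h (X \<omega>) * (Z \<omega> - m (X \<omega>))) \<partial>M) =
      (\<integral>\<omega>. of_bool (G \<omega> = 1) * (?\<chi> (X \<omega>) * (Z \<omega> - m (X \<omega>))) \<partial>M)"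
      by (metis (no_types, lifting) sum.neutral)
  qed
qed

text \<open>The hypothesis \<open>synth\<close> is what parallel trends and synthetic control have
  in common. Reweighting carries every control residual to group 1, where the weighted group means
  add up to \<open>\<mu> 1\<close>.\<close>

lemma contrast_moment_true_propensity:
  fixes D Z :: "'a \<Rightarrow> real" and w :: "nat \<Rightarrow> 'x \<Rightarrow> real" and m :: "'x \<Rightarrow> real"
  defines "\<mu> \<equiv> \<lambda>g. group_mean M N X G {g} Z" and "p \<equiv> group_prob M N X G"
  assumes D: "integrable M D" and Z: "integrable M Z" and DZ: "\<And>\<omega>. G \<omega> \<noteq> 1 \<Longrightarrow> D \<omega> = Z \<omega>"
    and w: "weights NG N w" and m[measurable]: "m \<in> borel_measurable N"
    and int: "integrable M (\<lambda>\<omega>. (of_bool (G \<omega> = 1) -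
      (\<Sum>h = 2..NG + 1. w h (X \<omega>) * (p 1 (X \<omega>) / p h (X \<omega>)) * of_bool (G \<omega> = h))) * (D \<omega> - m (X \<omega>)))"
    and synth: "AE \<omega> in M. \<mu> 1 (X \<omega>) = (\<Sum>h = 2..NG + 1. w h (X \<omega>) * \<mu> h (X \<omega>))"
  shows "(\<integral>\<omega>. (of_bool (G \<omega> = 1) -
      (\<Sum>h = 2..NG + 1. w h (X \<omega>) * (p 1 (X \<omega>) / p h (X \<omega>)) * of_bool (G \<omega> = h))) * (D \<omega> - m (X \<omega>)) \<partial>M) =
    (\<integral>\<omega>. of_bool (G \<omega> = 1) * (D \<omega> - Z \<omega>) \<partial>M)"
proof -
  have [measurable]: "\<mu> g \<in> borel_measurable N" "p g \<in> borel_measurable N" for g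
    unfolding \<mu>_def p_def by measurable
  have \<mu>_eq: "group_mean M N X G {g} Z = \<mu> g" for g
    by (simp add: \<mu>_def)
  have wm[measurable]: "h \<in> {2..NG + 1} \<Longrightarrow> w h \<in> borel_measurable N" for h
    using w by (auto simp: weights_def)
  have w1: "(\<Sum>h = 2..NG + 1. w h x) = 1" if "x \<in> space N" for x
    using w that by (simp add: weights_def)
  let ?a = "\<lambda>h x. w h x * (p 1 x / p h x)"
  \<comment> \<open>The third term bounds the group 1 integrand that is left after
    reweighting.\<close>
  let ?b = "\<lambda>h x. \<bar>?a h x\<bar> + \<bar>?a h x * m x\<bar> + \<bar>w h x * (\<mu> h x - m x)\<bar>"
  let ?B = "\<lambda>x. \<bar>m x\<bar> + (\<Sum>h = 2..NG + 1. ?b h x)"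
  have B: "?B \<in> borel_measurable N"
    by measurable
  have bounds: "\<bar>m x\<bar> \<le> ?B x" for x
    by (simp add: sum_nonneg)
  have bounds_h: "\<bar>?a h x\<bar> \<le> ?B x" "\<bar>?a h x * m x\<bar> \<le> ?B x" "\<bar>w h x * (\<mu> h x - m x)\<bar> \<le> ?B x"
    if "h \<in> {2..NG + 1}" for x h
  proof -
    have "?b h x \<le> (\<Sum>h = 2..NG + 1. ?b h x)"
      using that by (intro member_le_sum[where f="\<lambda>h. ?b h x"]) auto
    then show "\<bar>?a h x\<bar> \<le> ?B x" "\<bar>?a h x * m x\<bar> \<le> ?B x" "\<bar>w h x * (\<mu> h x - m x)\<bar> \<le> ?B x"
      using abs_ge_zero[of "m x"] abs_ge_zero[of "?a h x"] abs_ge_zero[of "?a h x * m x"]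
        abs_ge_zero[of "w h x * (\<mu> h x - m x)"] by linarith+
  qed
  have am: "?a h \<in> borel_measurable N" if "h \<in> {2..NG + 1}" for h
    using that by measurable
  show ?thesis
  proof (rule contrast_moment[where B="?B", OF D Z DZ am m B bounds bounds_h(1,2) int])
    fix k :: nat
    let ?\<chi> = "\<lambda>x. of_bool (?B x \<le> real k) :: real"
    have \<chi>[measurable]: "?\<chi> \<in> borel_measurable N"
      unfolding of_bool_def using B by measurable
    have cut: "\<bar>?\<chi> x * f\<bar> \<le> max 1 (real k)" if "\<bar>f\<bar> \<le> ?B x" for x f
      using that by (rule abs_of_bool_mult_le)
    have rm: "(\<lambda>x. ?\<chi> x * w h x) \<in> borel_measurable N" if "h \<in> {2..NG + 1}" for h
      using that by measurable
    have reweight: "integrable M (\<lambda>\<omega>. of_bool (G \<omega> = 1) * (?\<chi> (X \<omega>) * w h (X \<omega>) * (\<mu> h (X \<omega>) - m (X \<omega>))))"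
      "(\<integral>\<omega>. of_bool (G \<omega> = h) * (?\<chi> (X \<omega>) * ?a h (X \<omega>) * (Z \<omega> - m (X \<omega>))) \<partial>M) =
      (\<integral>\<omega>. of_bool (G \<omega> = 1) * (?\<chi> (X \<omega>) * w h (X \<omega>) * (\<mu> h (X \<omega>) - m (X \<omega>))) \<partial>M)"
      if h: "h \<in> {2..NG + 1}" for h
      using reweighted_residual_moment[of h "\<lambda>x. ?\<chi> x * w h x" m Z "max 1 (real k)", folded p_def, unfolded \<mu>_eq,
          OF _ rm[OF h] m Z]
        cut[OF bounds_h(1)[OF h]] cut[OF bounds_h(2)[OF h]] cut[OF bounds_h(3)[OF h]] h
      by (simp_all only: mult.assoc) auto
    have "(\<Sum>h = 2..NG + 1. \<integral>\<omega>. of_bool (G \<omega> = h) * (?\<chi> (X \<omega>) * ?a h (X \<omega>) * (Z \<omega> - m (X \<omega>))) \<partial>M) =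
        (\<Sum>h = 2..NG + 1. \<integral>\<omega>. of_bool (G \<omega> = 1) * (?\<chi> (X \<omega>) * w h (X \<omega>) * (\<mu> h (X \<omega>) - m (X \<omega>))) \<partial>M)"
      by (rule sum.cong[OF refl reweight(2)])
    also have "\<dots> = (\<integral>\<omega>. (\<Sum>h = 2..NG + 1.
        of_bool (G \<omega> = 1) * (?\<chi> (X \<omega>) * w h (X \<omega>) * (\<mu> h (X \<omega>) - m (X \<omega>)))) \<partial>M)"
      by (rule Bochner_Integration.integral_sum[symmetric, OF reweight(1)])
    also have "\<dots> = (\<integral>\<omega>. of_bool (G \<omega> = 1) * (?\<chi> (X \<omega>) * (\<mu> 1 (X \<omega>) - m (X \<omega>))) \<partial>M)"
    proof (rule integral_cong_AE)
      show "AE \<omega> in M. (\<Sum>h = 2..NG + 1.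
          of_bool (G \<omega> = 1) * (?\<chi> (X \<omega>) * w h (X \<omega>) * (\<mu> h (X \<omega>) - m (X \<omega>)))) =
          of_bool (G \<omega> = 1) * (?\<chi> (X \<omega>) * (\<mu> 1 (X \<omega>) - m (X \<omega>)))"
        using synth AE_space
      proof eventually_elim
        case (elim \<omega>)
        let ?x = "X \<omega>"
        \<comment> \<open>Since the weights sum to one, \<open>m\<close> leaves the sum with
          coefficient 1, and \<open>synth\<close> evaluates the rest.\<close>
        have "(\<Sum>h = 2..NG + 1. w h ?x * (\<mu> h ?x - m ?x)) =
            (\<Sum>h = 2..NG + 1. w h ?x * \<mu> h ?x) - (\<Sum>h = 2..NG + 1. w h ?x) * m ?x"
          by (simp only: right_diff_distrib sum_subtractf sum_distrib_right)
        also have "\<dots> = \<mu> 1 ?x - m ?x"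
          using elim w1[of ?x] measurable_space[OF X] by simp
        finally show ?case
          by (simp only: mult.assoc flip: sum_distrib_left)
      qed
    qed measurable
    \<comment> \<open>Iterated expectations in group 1, read backwards, replace
      \<open>\<mu> 1\<close> by \<open>Z\<close>.\<close>
    also have "\<dots> = (\<integral>\<omega>. of_bool (G \<omega> = 1) * (?\<chi> (X \<omega>) * (Z \<omega> - m (X \<omega>))) \<partial>M)"
    proof -
      have "\<bar>?\<chi> x\<bar> \<le> max 1 (real k)" for x
        by (rule abs_of_bool_le)
      then show ?thesis
        using group_residual_moment(3)[OF _ \<chi> m Z _ cut[OF bounds], of 1] by (simp add: \<mu>_def)
    qed
    finally show "(\<Sum>h = 2..NG + 1. \<integral>\<omega>. of_bool (G \<omega> = h) *
        (?\<chi> (X \<omega>) * ?a h (X \<omega>) * (Z \<omega> - m (X \<omega>))) \<partial>M) =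
      (\<integral>\<omega>. of_bool (G \<omega> = 1) * (?\<chi> (X \<omega>) * (Z \<omega> - m (X \<omega>))) \<partial>M)" .
  qed
qed

section \<open>The pooled regression of the untreated groups\<close>

text \<open>The pooled population is the disjoint union of groups 2 to \<open>NG + 1\<close>. If
  \<open>h\<close> satisfies the moment equations in each of them, adding these up gives the
  equations for the union, where \<open>D\<close> equals \<open>Z\<close>.\<close>

lemma pooled_group_mean:
  fixes D Z :: "'a \<Rightarrow> real"
  assumes NG: "NG \<ge> 1" and D: "integrable M D" and Z: "integrable M Z"
    and DZ: "\<And>\<omega>. G \<omega> \<noteq> 1 \<Longrightarrow> D \<omega> = Z \<omega>"
    and h[measurable]: "h \<in> borel_measurable N"
    and eq: "\<And>g. g \<in> {2..NG + 1} \<Longrightarrow> AE \<omega> in M. h (X \<omega>) = group_mean M N X G {g} Z (X \<omega>)"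
  shows "AE \<omega> in M. group_mean M N X G (- {1}) D (X \<omega>) = h (X \<omega>)"
proof -
  have [measurable]: "Z \<in> borel_measurable M" "D \<in> borel_measurable M"
    using Z D by auto
  have pool: "of_bool (G \<omega> \<in> - {1}) * c = (\<Sum>g = 2..NG + 1. of_bool (G \<omega> \<in> {g}) * c)"
    if "\<omega> \<in> space M" for \<omega> and c :: real
  proof -
    have "(\<Sum>g = 2..NG + 1. of_bool (G \<omega> \<in> {g}) :: real) = (\<Sum>g = 2..NG + 1. if g = G \<omega> then 1 else 0)"
      by (intro sum.cong) auto
    also have "\<dots> = of_bool (G \<omega> \<in> - {1})"
      using group_range[OF that] by (auto simp: sum.delta)
    finally show ?thesis
      by (simp flip: sum_distrib_right)
  qed
  have moments:
    "integrable M (\<lambda>\<omega>. of_bool (G \<omega> \<in> {g}) * (f (X \<omega>) * h (X \<omega>)))"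
    "integrable M (\<lambda>\<omega>. of_bool (G \<omega> \<in> {g}) * (f (X \<omega>) * Z \<omega>))"
    "(\<integral>\<omega>. of_bool (G \<omega> \<in> {g}) * (f (X \<omega>) * h (X \<omega>)) \<partial>M) =
      (\<integral>\<omega>. of_bool (G \<omega> \<in> {g}) * (f (X \<omega>) * Z \<omega>) \<partial>M)"
    if g: "g \<in> {2..NG + 1}" and f[measurable]: "f \<in> borel_measurable N" and f1: "\<And>x. \<bar>f x\<bar> \<le> 1" for f g
  proof -
    have g': "g \<in> {1..NG + 1}" "g \<in> {g}"
      using g by auto
    show int: "integrable M (\<lambda>\<omega>. of_bool (G \<omega> \<in> {g}) * (f (X \<omega>) * Z \<omega>))"
      by (rule integrable_group_mult_bounded[OF f Z f1])
    note m = group_mean_moment[OF g' f _ int]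
    have AE: "AE \<omega> in M. of_bool (G \<omega> \<in> {g}) * (f (X \<omega>) * h (X \<omega>)) =
        of_bool (G \<omega> \<in> {g}) * (f (X \<omega>) * group_mean M N X G {g} Z (X \<omega>))"
      using eq[OF g] by eventually_elim simp
    show "integrable M (\<lambda>\<omega>. of_bool (G \<omega> \<in> {g}) * (f (X \<omega>) * h (X \<omega>)))"
      by (subst integrable_cong_AE[OF _ _ AE]) (measurable, use m in simp)
    show "(\<integral>\<omega>. of_bool (G \<omega> \<in> {g}) * (f (X \<omega>) * h (X \<omega>)) \<partial>M) =
        (\<integral>\<omega>. of_bool (G \<omega> \<in> {g}) * (f (X \<omega>) * Z \<omega>) \<partial>M)"
      by (subst integral_cong_AE[OF _ _ AE]) (measurable, use m in simp)
  qed
  show ?thesis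
  \<comment> \<open>Group 2 exists because \<open>NG \<ge> 1\<close>; it serves as the member of
    \<open>- {1}\<close> from which overlap extends the equality.\<close>
  proof (rule group_mean_unique[where g=2])
    show "integrable M (\<lambda>\<omega>. of_bool (G \<omega> \<in> - {1}) * h (X \<omega>))"
    proof (rule iffD2[OF Bochner_Integration.integrable_cong[OF refl pool]])
      show "integrable M (\<lambda>\<omega>. \<Sum>g = 2..NG + 1. of_bool (G \<omega> \<in> {g}) * h (X \<omega>))"
        using moments(1)[of _ "\<lambda>_. 1"] by (intro Bochner_Integration.integrable_sum) auto
    qed
    fix f :: "'x \<Rightarrow> real"
    assume f: "f \<in> borel_measurable N" "\<And>x. \<bar>f x\<bar> \<le> 1"
    have "(\<integral>\<omega>. of_bool (G \<omega> \<in> - {1}) * (f (X \<omega>) * D \<omega>) \<partial>M) =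
        (\<integral>\<omega>. of_bool (G \<omega> \<in> - {1}) * (f (X \<omega>) * Z \<omega>) \<partial>M)"
      using DZ by (intro Bochner_Integration.integral_cong) auto
    also have "\<dots> = (\<Sum>g = 2..NG + 1. \<integral>\<omega>. of_bool (G \<omega> \<in> {g}) * (f (X \<omega>) * Z \<omega>) \<partial>M)"
      by (rule trans[OF Bochner_Integration.integral_cong[OF refl pool]
            Bochner_Integration.integral_sum[OF moments(2)[OF _ f]]])
    also have "\<dots> = (\<Sum>g = 2..NG + 1. \<integral>\<omega>. of_bool (G \<omega> \<in> {g}) * (f (X \<omega>) * h (X \<omega>)) \<partial>M)"
      by (intro sum.cong refl moments(3)[OF _ f, symmetric])
    also have "\<dots> = (\<integral>\<omega>. of_bool (G \<omega> \<in> - {1}) * (f (X \<omega>) * h (X \<omega>)) \<partial>M)"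
      by (rule trans[OF Bochner_Integration.integral_cong[OF refl pool]
            Bochner_Integration.integral_sum[OF moments(1)[OF _ f]], symmetric])
    finally show "(\<integral>\<omega>. of_bool (G \<omega> \<in> - {1}) * (f (X \<omega>) * D \<omega>) \<partial>M) =
        (\<integral>\<omega>. of_bool (G \<omega> \<in> - {1}) * (f (X \<omega>) * h (X \<omega>)) \<partial>M)" .
  qed (use NG D in auto)
qed

end

section \<open>Identification of the effect on group 1\<close>

text \<open>The integral of a non-integrable function is 0 by convention, so each moment equation is
  stated for an integrable \<open>phi\<close>.\<close>

theorem theorem1:
  fixes M :: "'a measure" and N :: "'x measure" and Q :: "'b measure"
    and NG T n :: nat
    and Y1 Y0 :: "nat \<Rightarrow> 'a \<Rightarrow> real" and G :: "'a \<Rightarrow> nat" and X :: "'a \<Rightarrow> 'x"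
    and sample :: "nat \<Rightarrow> 'b \<Rightarrow> (nat \<Rightarrow> real) \<times> nat \<times> 'x"
  defines "Y \<equiv> outcome Y1 Y0 G"
    and "S \<equiv> data T Y1 Y0 G X"
    and "m\<Delta> \<equiv> group_mean M N X G (- {1}) (\<lambda>\<omega>. outcome Y1 Y0 G T \<omega> - outcome Y1 Y0 G (T - 1) \<omega>)"
    and "p \<equiv> group_prob M N X G"
    and "\<pi>1 \<equiv> measure M {\<omega> \<in> space M. G \<omega> = 1}"
    and "\<theta> \<equiv> (\<integral>\<omega>. (Y1 T \<omega> - Y0 T \<omega>) \<partial>given_group M G {1})"
  assumes "prob_space M"
    and periods: "2 \<le> T"
    and "G \<in> measurable M (count_space {1..NG + 1})"
    and "X \<in> measurable M N"
    and "\<And>t. t \<in> {1..T} \<Longrightarrow> Y1 t \<in> borel_measurable M"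
    and "\<And>t. t \<in> {1..T} \<Longrightarrow> integrable M (Y0 t)"
    and "\<And>t. t \<in> {1..T} \<Longrightarrow> integrable M (Y t)"
    and no_anticipation: "\<And>t. t \<in> {1..T - 1} \<Longrightarrow> AE \<omega> in M. Y1 t \<omega> = Y0 t \<omega>"
    and iid: "iid_sample Q n (distr M (data_space NG T N) S) sample"
    and overlap: "\<And>g. g \<in> {1..NG + 1} \<Longrightarrow> AE \<omega> in M. p g (X \<omega>) > 0"
  shows
    "(parallel_trends M N NG T Y0 G X \<longrightarrow>
       (\<forall>w' p' m'.
          weights NG N w' \<longrightarrow>
          (\<forall>g\<in>{1..NG + 1}. p' g \<in> borel_measurable N \<and> (\<forall>x\<in>space N. p' g x \<noteq> 0)) \<longrightarrow>
          m' \<in> borel_measurable N \<longrightarrow>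
          (integrable M (\<lambda>\<omega>. phi NG T m\<Delta> p' w' \<pi>1 (S \<omega>)) \<longrightarrow>
             \<theta> = (\<integral>\<omega>. phi NG T m\<Delta> p' w' \<pi>1 (S \<omega>) \<partial>M)) \<and>
          (integrable M (\<lambda>\<omega>. phi NG T m' p w' \<pi>1 (S \<omega>)) \<longrightarrow>
             \<theta> = (\<integral>\<omega>. phi NG T m' p w' \<pi>1 (S \<omega>) \<partial>M)))) \<and>
     (\<forall>w. synthetic_control M N NG T Y0 G X w \<longrightarrow>
       (\<forall>m'. m' \<in> borel_measurable N \<longrightarrow>
          integrable M (\<lambda>\<omega>. phi NG T m' p w \<pi>1 (S \<omega>)) \<longrightarrow>
          \<theta> = (\<integral>\<omega>. phi NG T m' p w \<pi>1 (S \<omega>) \<partial>M)))"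
proof -
  interpret prob_space M by fact
  have overlap': "AE \<omega> in M. group_prob M N X G g (X \<omega>) > 0" if "g \<in> {1..NG + 1}" for g
    using overlap[OF that] by (simp add: p_def)
  interpret grouped_population M N X G NG
    by unfold_locales (use assms(9,10) overlap' in auto)
  define D where "D \<omega> = Y T \<omega> - Y (T - 1) \<omega>" for \<omega>
  define Z where "Z \<omega> = Y0 T \<omega> - Y0 (T - 1) \<omega>" for \<omega>
  let ?\<mu> = "\<lambda>g. group_mean M N X G {g} Z"
  \<comment> \<open>With at least two periods, \<open>T - 1\<close> is a genuine pre-treatment
    period covered by no anticipation.\<close>
  have TT: "T \<in> {1..T}" "T - 1 \<in> {1..T}" "T - 1 \<in> {1..T - 1}"
    using periods by auto
  note Y0_int = assms(12)
  have D: "integrable M D" and Z: "integrable M Z"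
    unfolding D_def Z_def using assms(13)[OF TT(1)] assms(13)[OF TT(2)] Y0_int[OF TT(1)] Y0_int[OF TT(2)] by simp_all
  have [measurable]: "Y1 T \<in> borel_measurable M" "Y0 T \<in> borel_measurable M" "D \<in> borel_measurable M"
    "Z \<in> borel_measurable M"
    using assms(11)[OF TT(1)] Y0_int[OF TT(1)] D Z by auto
  have DZ: "D \<omega> = Z \<omega>" if "G \<omega> \<noteq> 1" for \<omega>
    using that by (simp add: D_def Z_def Y_def outcome_def)
  have m\<Delta>: "m\<Delta> = group_mean M N X G (- {1}) D"
    by (simp add: m\<Delta>_def D_def[abs_def] Y_def)
  have m\<Delta>_meas: "m\<Delta> \<in> borel_measurable N"
    unfolding m\<Delta> by measurable
  have \<theta>: "\<theta> = (\<integral>\<omega>. of_bool (G \<omega> = 1) * (D \<omega> - Z \<omega>) \<partial>M) / \<pi>1"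
  proof -
    have "\<theta> = (\<integral>\<omega>. of_bool (G \<omega> \<in> {1}) * (Y1 T \<omega> - Y0 T \<omega>) \<partial>M) / measure M {\<omega> \<in> space M. G \<omega> \<in> {1}}"
      unfolding \<theta>_def by (rule given_group_moment[where g=1]) auto
    \<comment> \<open>In group 1, \<open>D - Z\<close> is the treatment effect at \<open>T\<close>
      minus that at \<open>T - 1\<close>; the latter vanishes almost surely by no
      anticipation.\<close>
    also have "(\<integral>\<omega>. of_bool (G \<omega> \<in> {1}) * (Y1 T \<omega> - Y0 T \<omega>) \<partial>M) =
        (\<integral>\<omega>. of_bool (G \<omega> = 1) * (D \<omega> - Z \<omega>) \<partial>M)"
      using no_anticipation[OF TT(3)]
      by (intro integral_cong_AE) (measurable, auto simp: D_def Z_def Y_def outcome_def)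
    finally show ?thesis
      by (simp add: \<pi>1_def)
  qed
  have \<pi>1: "\<pi>1 > 0"
    using group_pos[of 1 "{1}"] by (simp add: \<pi>1_def)
  \<comment> \<open>This is the moment function without its factor \<open>1 / \<pi>1\<close>, with
    the weights and probability ratios merged into one coefficient \<open>a\<close>, as in the
    contrast lemmas.\<close>
  define F where "F m a = (\<lambda>\<omega>. (of_bool (G \<omega> = 1) - (\<Sum>h = 2..NG + 1. a h (X \<omega>) * of_bool (G \<omega> = h))) *
    (D \<omega> - m (X \<omega>)))" for m and a :: "nat \<Rightarrow> 'x \<Rightarrow> real"
  have phi: "phi NG T m q w \<pi>1 (S \<omega>) = inverse \<pi>1 * F m (\<lambda>h x. w h x * (q 1 x / q h x)) \<omega>" for m q w \<omega>
    using TT by (simp add: phi_def S_def data_def F_def D_def Y_def divide_inverse mult.assoc del: sum.cl_ivl_Suc)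
  have identify: "\<theta> = (\<integral>\<omega>. phi NG T m q w \<pi>1 (S \<omega>) \<partial>M)"
    if int: "integrable M (\<lambda>\<omega>. phi NG T m q w \<pi>1 (S \<omega>))"
      and moment: "integrable M (F m (\<lambda>h x. w h x * (q 1 x / q h x))) \<Longrightarrow>
        (\<integral>\<omega>. F m (\<lambda>h x. w h x * (q 1 x / q h x)) \<omega> \<partial>M) = (\<integral>\<omega>. of_bool (G \<omega> = 1) * (D \<omega> - Z \<omega>) \<partial>M)" for m q w
    using int moment \<pi>1 unfolding phi \<theta> by (simp add: divide_inverse mult.commute)
  \<comment> \<open>Both claims with the true \<open>p\<close>, under parallel trends and under
    synthetic control, come down to this one.\<close>
  have true_p: "\<theta> = (\<integral>\<omega>. phi NG T m' p w \<pi>1 (S \<omega>) \<partial>M)"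
    if "weights NG N w" "m' \<in> borel_measurable N"
      and "AE \<omega> in M. ?\<mu> 1 (X \<omega>) = (\<Sum>h = 2..NG + 1. w h (X \<omega>) * ?\<mu> h (X \<omega>))"
      and "integrable M (\<lambda>\<omega>. phi NG T m' p w \<pi>1 (S \<omega>))" for w m'
    by (rule identify[OF that(4)], unfold F_def p_def,
        rule contrast_moment_true_propensity[OF D Z DZ that(1,2) _ that(3)])
  have "\<theta> = (\<integral>\<omega>. phi NG T m\<Delta> p' w' \<pi>1 (S \<omega>) \<partial>M)"
    if PT: "parallel_trends M N NG T Y0 G X" and w': "weights NG N w'"
      and p': "\<forall>g\<in>{1..NG + 1}. p' g \<in> borel_measurable N \<and> (\<forall>x\<in>space N. p' g x \<noteq> 0)"
      and int: "integrable M (\<lambda>\<omega>. phi NG T m\<Delta> p' w' \<pi>1 (S \<omega>))" for w' p'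
  proof (rule identify[OF int], unfold F_def, rule contrast_moment_true_regression[OF D Z DZ _ m\<Delta>_meas])
    have trends: "AE \<omega> in M. ?\<mu> 1 (X \<omega>) = ?\<mu> g (X \<omega>)" if "g \<in> {1..NG + 1}" for g
      using PT that unfolding parallel_trends_def Z_def by (cases "g = 1") auto
    \<comment> \<open>Without control groups the empty sum of weights would have to be 1 at each
      point of \<open>space N\<close>, which is non-empty because it contains the values of
      \<open>X\<close>.\<close>
    have "NG \<ge> 1"
    proof (rule ccontr)
      assume "\<not> NG \<ge> 1"
      then have "space N = {}"
        using w' by (auto simp: weights_def)
      then show False
        using not_empty measurable_space[OF X] by auto
    qed
    \<comment> \<open>By parallel trends the group 1 mean is a version of every control group's
      mean, so it can stand for \<open>h\<close> in the pooling lemma.\<close>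
    then have "AE \<omega> in M. m\<Delta> (X \<omega>) = ?\<mu> 1 (X \<omega>)"
      unfolding m\<Delta> using trends by (intro pooled_group_mean[OF _ D Z DZ]) auto
    then show "AE \<omega> in M. m\<Delta> (X \<omega>) = ?\<mu> g (X \<omega>)" if "g \<in> {1..NG + 1}" for g
      using trends[OF that] by eventually_elim simp
    show "(\<lambda>x. w' h x * (p' 1 x / p' h x)) \<in> borel_measurable N" if "h \<in> {2..NG + 1}" for h
    proof -
      have [measurable]: "w' h \<in> borel_measurable N" "p' 1 \<in> borel_measurable N" "p' h \<in> borel_measurable N"
        using w' p' that by (auto simp: weights_def)
      show ?thesis
        by measurable
    qed
  qed
  moreover have "\<theta> = (\<integral>\<omega>. phi NG T m' p w' \<pi>1 (S \<omega>) \<partial>M)"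
    if PT: "parallel_trends M N NG T Y0 G X" and w': "weights NG N w'" and m': "m' \<in> borel_measurable N"
      and int: "integrable M (\<lambda>\<omega>. phi NG T m' p w' \<pi>1 (S \<omega>))" for w' m'
  proof (rule true_p[OF w' m' _ int])
    have "AE \<omega> in M. \<forall>g\<in>{2..NG + 1}. ?\<mu> 1 (X \<omega>) = ?\<mu> g (X \<omega>)"
      using PT unfolding parallel_trends_def Z_def by (intro AE_finite_allI) auto
    then show "AE \<omega> in M. ?\<mu> 1 (X \<omega>) = (\<Sum>h = 2..NG + 1. w' h (X \<omega>) * ?\<mu> h (X \<omega>))"
      using AE_space
    proof eventually_elim
      case (elim \<omega>)
      have "(\<Sum>h = 2..NG + 1. w' h (X \<omega>) * ?\<mu> h (X \<omega>)) = (\<Sum>h = 2..NG + 1. w' h (X \<omega>)) * ?\<mu> 1 (X \<omega>)"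
        unfolding sum_distrib_right using elim by (intro sum.cong) auto
      then show ?case
        using w' elim measurable_space[OF X] by (simp add: weights_def del: sum.cl_ivl_Suc)
    qed
  qed
  moreover have "\<theta> = (\<integral>\<omega>. phi NG T m' p w \<pi>1 (S \<omega>) \<partial>M)"
    if SC: "synthetic_control M N NG T Y0 G X w" and m': "m' \<in> borel_measurable N"
      and int: "integrable M (\<lambda>\<omega>. phi NG T m' p w \<pi>1 (S \<omega>))" for w m'
  proof (rule true_p[OF _ m' _ int])
    show "weights NG N w"
      using SC by (simp add: synthetic_control_def)
    have sc: "AE \<omega> in M. \<forall>t\<in>{1..T}. group_mean M N X G {1} (Y0 t) (X \<omega>) =
        (\<Sum>g = 2..NG + 1. w g (X \<omega>) * group_mean M N X G {g} (Y0 t) (X \<omega>))"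
      using SC by (auto simp: synthetic_control_def dest!: AE_distrD[OF X])
    have diff: "AE \<omega> in M. \<forall>g\<in>{1..NG + 1}. ?\<mu> g (X \<omega>) =
        group_mean M N X G {g} (Y0 T) (X \<omega>) - group_mean M N X G {g} (Y0 (T - 1)) (X \<omega>)"
      unfolding Z_def
      by (intro AE_finite_allI group_mean_diff singletonI Y0_int TT(1,2)) auto
    show "AE \<omega> in M. ?\<mu> 1 (X \<omega>) = (\<Sum>h = 2..NG + 1. w h (X \<omega>) * ?\<mu> h (X \<omega>))"
      using sc diff
    proof eventually_elim
      case (elim \<omega>)
      let ?\<nu> = "\<lambda>t g. group_mean M N X G {g} (Y0 t) (X \<omega>)"
      have "?\<mu> 1 (X \<omega>) = ?\<nu> T 1 - ?\<nu> (T - 1) 1"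
        using elim(2) by simp
      \<comment> \<open>The synthetic control equation is taken at the last two periods with the
        same weights, so subtracting one from the other gives an equation for trends.\<close>
      also have "\<dots> = (\<Sum>h = 2..NG + 1. w h (X \<omega>) * ?\<nu> T h) - (\<Sum>h = 2..NG + 1. w h (X \<omega>) * ?\<nu> (T - 1) h)"
        by (simp only: bspec[OF elim(1) TT(1)] bspec[OF elim(1) TT(2)])
      also have "\<dots> = (\<Sum>h = 2..NG + 1. w h (X \<omega>) * ?\<mu> h (X \<omega>))"
        unfolding sum_subtractf[symmetric] right_diff_distrib[symmetric]
        using elim(2) by (intro sum.cong refl) auto
      finally show ?case .
    qed
  qed
  ultimately show ?thesis
    by blast
qed

end
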